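(* Let $H$ be a complex Hilbert space, let $T\in\mathcal{B}(H)$ and let $T=V|T|$ be the polar decomposition of $T$. If $\ker(T^* )\subseteq\ker(T)$, then $$M(T)=V\left(\frac{|T|+V^*|T|V}{2}\right)\quad\text{and}\quad M(T)^*=V^*\left(\frac{|T|+V|T|V^*}{2}\right)$$ are the polar decompositions of $M(T)$ and $M(T)^*$ respectively.
   Context: $\mathcal{B}(H)$ is the algebra of bounded linear operators on $H$. For $A\in\mathcal{B}(H)$, $|A|=(A^*A)^{1/2}$, and the polar decomposition of $A$ is the factorization $A=W|A|$ where $W$ is the unique partial isometry with $A=W|A|$ and $\ker(W)=\ker(A)$. The mean transform of $T=V|T|$ is $M(T)=\frac12(T+|T|V)$. Thus the claim asserts that the displayed identities hold, that $|M(T)|=\frac12(|T|+V^*|T|V)$ and $|M(T)^*|=\frac12(|T|+V|T|V^* )$, and that $\ker(V)=\ker(M(T))$ and $\ker(V^* )=\ker(M(T)^* )$. *)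

theory Defs
  imports "HOL-Analysis.Analysis" "HOL-Library.Nonpos_Ints"
begin

text \<open>The norm, the metric and the real scalar multiplication are those of the library class
  \<^class>\<open>real_normed_vector\<close>. The inner product is linear in its first argument.\<close>

class complex_inner = real_normed_vector +
  fixes scaleC :: "complex \<Rightarrow> 'a \<Rightarrow> 'a"  (infixr "*\<^sub>C" 75)
    and cinner :: "'a \<Rightarrow> 'a \<Rightarrow> complex"
  assumes scaleC_add_right: "a *\<^sub>C (x + y) = a *\<^sub>C x + a *\<^sub>C y"
    and scaleC_add_left: "(a + b) *\<^sub>C x = a *\<^sub>C x + b *\<^sub>C x"
    and scaleC_scaleC: "a *\<^sub>C b *\<^sub>C x = (a * b) *\<^sub>C x"
    and scaleC_one: "1 *\<^sub>C x = x"
    and scaleR_scaleC: "r *\<^sub>R x = complex_of_real r *\<^sub>C x"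
    and cinner_commute: "cinner x y = cnj (cinner y x)"
    and cinner_add_left: "cinner (x + y) z = cinner x z + cinner y z"
    and cinner_scaleC_left: "cinner (a *\<^sub>C x) y = a * cinner x y"
    and cinner_self_nonneg: "0 \<le> Re (cinner x x)"
    and cinner_self_eq_zero_iff: "cinner x x = 0 \<longleftrightarrow> x = 0"
    and norm_eq_sqrt_cinner: "norm x = sqrt (Re (cinner x x))"

class chilbert_space = complex_inner + complete_space

instantiation complex :: chilbert_space
begin

definition scaleC_complex :: "complex \<Rightarrow> complex \<Rightarrow> complex"
  where "scaleC_complex a x = a * x"

definition cinner_complex :: "complex \<Rightarrow> complex \<Rightarrow> complex"
  where "cinner_complex x y = x * cnj y"

instance
proof
  fix x :: complex
  show "norm x = sqrt (Re (cinner x x))"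
    by (simp add: cinner_complex_def cmod_def power2_eq_square)
qed (auto simp: scaleC_complex_def cinner_complex_def algebra_simps scaleR_conv_of_real)

end

text \<open>The elements of \<open>\<B>(H)\<close> are the functions satisfying the following predicate; the
  product of operators is function composition.\<close>

definition bounded_clinear :: "('a::complex_inner \<Rightarrow> 'b::complex_inner) \<Rightarrow> bool"
  where "bounded_clinear A \<longleftrightarrow> bounded_linear A \<and> (\<forall>c x. A (c *\<^sub>C x) = c *\<^sub>C A x)"

definition op_ker :: "('a::complex_inner \<Rightarrow> 'b::complex_inner) \<Rightarrow> 'a set"
  where "op_ker A = {x. A x = 0}"

definition orth_compl :: "'a::complex_inner set \<Rightarrow> 'a set"
  where "orth_compl S = {x. \<forall>y\<in>S. cinner x y = 0}"

definition cadjoint :: "('a::chilbert_space \<Rightarrow> 'a) \<Rightarrow> 'a \<Rightarrow> 'a"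
  where "cadjoint A =
    (THE B. bounded_clinear B \<and> (\<forall>x y. cinner (A x) y = cinner x (B y)))"

text \<open>Self-adjointness need not be demanded: it follows by polarization, the scalars being
  complex.\<close>

definition positive_op :: "('a::chilbert_space \<Rightarrow> 'a) \<Rightarrow> bool"
  where "positive_op A \<longleftrightarrow>
    bounded_clinear A \<and> (\<forall>x. cinner (A x) x \<in> \<real>\<^sub>\<ge>\<^sub>0)"

definition sqrt_op :: "('a::chilbert_space \<Rightarrow> 'a) \<Rightarrow> 'a \<Rightarrow> 'a"
  where "sqrt_op A = (THE B. positive_op B \<and> B \<circ> B = A)"

definition abs_op :: "('a::chilbert_space \<Rightarrow> 'a) \<Rightarrow> 'a \<Rightarrow> 'a"
  where "abs_op A = sqrt_op (cadjoint A \<circ> A)"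

definition partial_isometry :: "('a::chilbert_space \<Rightarrow> 'a) \<Rightarrow> bool"
  where "partial_isometry W \<longleftrightarrow>
    bounded_clinear W \<and> (\<forall>x \<in> orth_compl (op_ker W). norm (W x) = norm x)"

text \<open>\<open>polar_decomposition A W P\<close>: the factorization \<open>A = W P\<close> is the polar decomposition
  of \<open>A\<close>; in particular \<open>P\<close> is the absolute value of \<open>A\<close>.\<close>

definition polar_decomposition ::
    "('a::chilbert_space \<Rightarrow> 'a) \<Rightarrow> ('a \<Rightarrow> 'a) \<Rightarrow> ('a \<Rightarrow> 'a) \<Rightarrow> bool"
  where "polar_decomposition A W P \<longleftrightarrow>
    partial_isometry W \<and> P = abs_op A \<and> A = W \<circ> P \<and> op_ker W = op_ker A"

definition polar_isometry :: "('a::chilbert_space \<Rightarrow> 'a) \<Rightarrow> 'a \<Rightarrow> 'a"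
  where "polar_isometry A = (THE W. polar_decomposition A W (abs_op A))"

definition mean_transform :: "('a::chilbert_space \<Rightarrow> 'a) \<Rightarrow> 'a \<Rightarrow> 'a"
  where "mean_transform T =
    (\<lambda>x. (1/2) *\<^sub>R (T x + abs_op T (polar_isometry T x)))"

end

theory Submission
  imports Defs
begin

text \<open>Write \<open>P = |T|\<close>. On the range of \<open>P\<close>, which is orthogonal to \<open>ker P = ker V\<close>, the initial
  projection \<open>V\<^sup>* V\<close> is the identity. Also \<open>ker V\<^sup>* = ker T\<^sup>*\<close>, so the hypothesis makes the range
  of \<open>P\<close> orthogonal to \<open>ker V\<^sup>*\<close> as well, and the final projection \<open>V V\<^sup>*\<close> is the identity there too
  (\<open>polar_final_projection\<close>). Therefore \<open>P V = V V\<^sup>* P V\<close> and \<open>M(T) = (V P + P V) / 2\<close> factors as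
  \<open>V Q\<close> with the positive operator \<open>Q = (P + V\<^sup>* P V) / 2\<close>. Since \<open>V\<^sup>* V Q = Q\<close>, the square of \<open>Q\<close>
  is \<open>M(T)\<^sup>* M(T)\<close>, that is, \<open>Q = |M(T)|\<close>. For the kernels, \<open>Q x = 0\<close> forces
  \<open>\<langle>P x, x\<rangle> = 0\<close>, because both summands are positive, hence \<open>P x = 0\<close> and \<open>V x = 0\<close>.

  The factorization is the same for \<open>M(T)\<^sup>* = (V\<^sup>* P + P V\<^sup>*) / 2\<close> with \<open>V\<^sup>*\<close> in place of \<open>V\<close>
  (\<open>polar_decomposition_mean\<close>). Only the kernels differ: there a null vector \<open>x\<close> of the positive
  factor satisfies \<open>P V\<^sup>* x = 0\<close>, so that \<open>V\<^sup>* x\<close> lies in \<open>ker V\<close>, to which it is also orthogonal.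

  The notions involved are definite descriptions, so they have to be shown to be well defined:
  adjoints exist by the Riesz representation theorem, a positive operator has exactly one positive
  square root (\<open>positive_sqrt_exists\<close>, \<open>positive_sqrt_unique\<close>), and the partial isometry of a
  polar decomposition is unique (\<open>polar_isometry_eq\<close>). Facts about kernels and ranges are
  derived from the inclusion of the range of an adjoint \<open>A\<^sup>*\<close> in the orthogonal complement of
  \<open>ker A\<close>, in place of orthogonal decompositions of the whole space.\<close>

section \<open>Inner products and bounded operators\<close>

lemma cinner_add_right: "cinner x (y + z) = cinner x y + cinner x (z::'a::complex_inner)"
  by (subst (1 2 3) cinner_commute) (simp add: cinner_add_left)

lemma cinner_scaleC_right: "cinner x (a *\<^sub>C y) = cnj a * cinner x (y::'a::complex_inner)"
  by (subst (1 2) cinner_commute) (simp add: cinner_scaleC_left)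

lemma cinner_scaleR_left: "cinner (r *\<^sub>R x) y = of_real r * cinner x (y::'a::complex_inner)"
  by (simp add: scaleR_scaleC cinner_scaleC_left)

lemma cinner_scaleR_right: "cinner x (r *\<^sub>R y) = of_real r * cinner x (y::'a::complex_inner)"
  by (simp add: scaleR_scaleC cinner_scaleC_right)

lemma cinner_minus_left: "cinner (- x) y = - cinner x (y::'a::complex_inner)"
  using cinner_scaleR_left[of "-1" x y] by simp

lemma cinner_minus_right: "cinner x (- y) = - cinner x (y::'a::complex_inner)"
  using cinner_scaleR_right[of x "-1" y] by simp

lemma cinner_diff_left: "cinner (x - y) z = cinner x z - cinner y (z::'a::complex_inner)"
  using cinner_add_left[of x "- y" z] by (simp add: cinner_minus_left)

lemma cinner_diff_right: "cinner x (y - z) = cinner x y - cinner x (z::'a::complex_inner)"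
  using cinner_add_right[of x y "- z"] by (simp add: cinner_minus_right)

lemma cinner_zero_left [simp]: "cinner 0 (y::'a::complex_inner) = 0"
  using cinner_scaleR_left[of 0 0 y] by simp

lemma cinner_zero_right [simp]: "cinner (x::'a::complex_inner) 0 = 0"
  using cinner_scaleR_right[of x 0 0] by simp

lemmas cinner_simps = cinner_add_left cinner_add_right cinner_diff_left cinner_diff_right
  cinner_scaleR_left cinner_scaleR_right

lemma Re_cinner_commute: "Re (cinner x y) = Re (cinner y (x::'a::complex_inner))"
  by (subst cinner_commute) simp

lemma norm_squared_cinner: "(norm (x::'a::complex_inner))\<^sup>2 = Re (cinner x x)"
  by (simp add: norm_eq_sqrt_cinner cinner_self_nonneg)

lemma cinner_self: "cinner x x = of_real ((norm (x::'a::complex_inner))\<^sup>2)"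
proof -
  have "Im (cinner x x) = Im (cnj (cinner x x))"
    by (subst cinner_commute) simp
  then show ?thesis
    by (simp add: complex_eq_iff norm_squared_cinner)
qed

lemma norm_scaleC: "norm (c *\<^sub>C x) = cmod c * norm (x::'a::complex_inner)"
proof (rule power2_eq_imp_eq)
  have "(norm (c *\<^sub>C x))\<^sup>2 = Re ((c * cnj c) * cinner x x)"
    unfolding norm_squared_cinner cinner_scaleC_left cinner_scaleC_right
    by (simp add: algebra_simps)
  also have "\<dots> = (cmod c)\<^sup>2 * (norm x)\<^sup>2"
    unfolding cinner_self complex_norm_square[symmetric] of_real_mult[symmetric] by simp
  finally show "(norm (c *\<^sub>C x))\<^sup>2 = (cmod c * norm x)\<^sup>2"
    by (simp add: power_mult_distrib)
qed simp_all

lemma norm_add_squared: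
  "(norm (x + y))\<^sup>2 = (norm x)\<^sup>2 + 2 * Re (cinner x y) + (norm (y::'a::complex_inner))\<^sup>2"
  using Re_cinner_commute[of x y] by (simp add: norm_squared_cinner cinner_simps)

lemma norm_diff_squared:
  "(norm (x - y))\<^sup>2 = (norm x)\<^sup>2 - 2 * Re (cinner x y) + (norm (y::'a::complex_inner))\<^sup>2"
  using Re_cinner_commute[of x y] by (simp add: norm_squared_cinner cinner_simps)

text \<open>The norm is part of the class, so its triangle inequality is available and the
  Cauchy-Schwarz inequality can be read off from it.\<close>

lemma Re_cinner_le: "Re (cinner x y) \<le> norm x * norm (y::'a::complex_inner)"
proof -
  have "(norm (x + y))\<^sup>2 \<le> (norm x + norm y)\<^sup>2"
    by (intro power_mono norm_triangle_ineq) simp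
  then show ?thesis
    by (simp add: norm_add_squared power2_sum)
qed

lemma bounded_linear_Re_cinner_left:
  "bounded_linear (\<lambda>x. Re (cinner x (y::'a::complex_inner)))"
proof (rule bounded_linear_intro[where K = "norm y"])
  fix x
  show "norm (Re (cinner x y)) \<le> norm x * norm y"
    using Re_cinner_le[of x y] Re_cinner_le[of "- x" y] by (simp add: cinner_minus_left)
qed (simp_all add: cinner_simps)

lemma bounded_linear_Re_cinner_right:
  "bounded_linear (\<lambda>x. Re (cinner (y::'a::complex_inner) x))"
  using bounded_linear_Re_cinner_left[of y] by (simp add: Re_cinner_commute[of y])

lemma Re_cinner_ext:
  assumes "\<And>x. Re (cinner x y) = Re (cinner x (z::'a::complex_inner))"
  shows "y = z"
proof -
  have "Re (cinner (y - z) (y - z)) = 0"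
    using assms[of "y - z"] by (simp add: cinner_diff_right)
  then show ?thesis
    by (simp flip: norm_squared_cinner)
qed

text \<open>An adjointness relation may be checked on real parts only, since the imaginary part of a
  form that is linear in its first argument is the real part at a rotated argument.\<close>

lemma adjoint_from_Re:
  fixes A :: "'a::complex_inner \<Rightarrow> 'b::complex_inner" and B :: "'b \<Rightarrow> 'a"
  assumes hom: "\<And>c x. A (c *\<^sub>C x) = c *\<^sub>C A x"
    and re: "\<And>x y. Re (cinner (A x) y) = Re (cinner x (B y))"
  shows "cinner (A x) y = cinner x (B y)"
proof (rule complex_eqI)
  show "Im (cinner (A x) y) = Im (cinner x (B y))"
    using re[of "(- \<i>) *\<^sub>C x" y] by (simp add: hom cinner_scaleC_left)
qed (rule re)

lemma bounded_clinearI: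
  assumes "\<And>x y. A (x + y) = A x + A y" and "\<And>c x. A (c *\<^sub>C x) = c *\<^sub>C A x"
    and "\<And>x. norm (A x) \<le> norm x * K"
  shows "bounded_clinear A"
  unfolding bounded_clinear_def
  using assms by (auto intro!: bounded_linear_intro[where K = K] simp: scaleR_scaleC)

lemma bounded_clinear_bounded_linear: "bounded_clinear A \<Longrightarrow> bounded_linear A"
  and bounded_clinear_scaleC: "bounded_clinear A \<Longrightarrow> A (c *\<^sub>C x) = c *\<^sub>C A x"
  by (auto simp: bounded_clinear_def)

lemma bounded_clinear_add: "bounded_clinear A \<Longrightarrow> A (x + y) = A x + A y"
  and bounded_clinear_diff: "bounded_clinear A \<Longrightarrow> A (x - y) = A x - A y"
  and bounded_clinear_zero: "bounded_clinear A \<Longrightarrow> A 0 = 0"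
  and bounded_clinear_scaleR: "bounded_clinear A \<Longrightarrow> A (r *\<^sub>R x) = r *\<^sub>R A x"
  using linear_add linear_diff linear_0 linear_scale bounded_linear.linear
    bounded_clinear_bounded_linear by metis+

lemmas bounded_clinear_simps =
  bounded_clinear_add bounded_clinear_diff bounded_clinear_zero bounded_clinear_scaleR

lemma scaleC_scaleR_commute: "c *\<^sub>C r *\<^sub>R x = r *\<^sub>R c *\<^sub>C (x::'a::complex_inner)"
  by (simp add: scaleR_scaleC scaleC_scaleC mult.commute)

lemma scaleC_diff_right: "c *\<^sub>C (x - y) = c *\<^sub>C x - c *\<^sub>C (y::'a::complex_inner)"
  using scaleC_add_right[of c "x - y" y] by (simp add: algebra_simps)

lemma bounded_clinear_compose:
  "bounded_clinear A \<Longrightarrow> bounded_clinear B \<Longrightarrow> bounded_clinear (\<lambda>x. A (B x))"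
  by (simp add: bounded_clinear_def bounded_linear_compose)

lemma bounded_clinear_sum:
  "bounded_clinear A \<Longrightarrow> bounded_clinear B \<Longrightarrow> bounded_clinear (\<lambda>x. A x + B x)"
  by (simp add: bounded_clinear_def bounded_linear_add scaleC_add_right)

lemma bounded_clinear_difference:
  "bounded_clinear A \<Longrightarrow> bounded_clinear B \<Longrightarrow> bounded_clinear (\<lambda>x. A x - B x)"
  by (simp add: bounded_clinear_def bounded_linear_sub scaleC_diff_right)

lemma bounded_clinear_scaled: "bounded_clinear A \<Longrightarrow> bounded_clinear (\<lambda>x. r *\<^sub>R A x)"
  by (simp add: bounded_clinear_def bounded_linear_const_scaleR scaleC_scaleR_commute)

lemma bounded_clinear_ident: "bounded_clinear (\<lambda>x. x)"
  by (simp add: bounded_clinear_def bounded_linear_ident)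

lemmas bounded_clinear_intros = bounded_clinear_sum bounded_clinear_difference
  bounded_clinear_scaled bounded_clinear_ident


section \<open>The Riesz representation theorem and adjoints\<close>

text \<open>Completing the square suggests that the representing vector of a real functional \<open>g\<close>
  minimizes \<open>J x = (norm x)\<^sup>2 - 2 * g x\<close>. The parallelogram law makes every minimizing sequence
  Cauchy, and the derivative of \<open>J\<close> vanishes at the minimizer, which is the claim.\<close>

lemma Riesz_representation_Re:
  fixes g :: "'a::chilbert_space \<Rightarrow> real"
  assumes g: "bounded_linear g"
  shows "\<exists>z. \<forall>x. g x = Re (cinner x z)"
proof -
  define J where "J x = (norm x)\<^sup>2 - 2 * g x" for x
  define m where "m = Inf (range J)"
  interpret g: bounded_linear g by (rule g)
  obtain K where K: "\<And>x. norm (g x) \<le> norm x * K"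
    using g.bounded by blast
  have "- K\<^sup>2 \<le> J x" for x
  proof -
    have "0 \<le> (norm x - K)\<^sup>2" by simp
    also have "\<dots> = (norm x)\<^sup>2 - 2 * (norm x * K) + K\<^sup>2"
      by (simp add: power2_diff)
    also have "\<dots> \<le> (norm x)\<^sup>2 - 2 * g x + K\<^sup>2"
      using K[of x] by simp
    finally show ?thesis by (simp add: J_def)
  qed
  then have bdd: "bdd_below (range J)"
    by (auto intro!: bdd_belowI)
  have m_le: "m \<le> J x" for x
    unfolding m_def by (rule cInf_lower[OF _ bdd]) simp
  have close: "(norm (x - y))\<^sup>2 \<le> 2 * (J x - m) + 2 * (J y - m)" for x y
  proof -
    have "(norm (x - y))\<^sup>2 = 2 * J x + 2 * J y - 4 * J ((1/2) *\<^sub>R (x + y))"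
      by (simp add: J_def norm_diff_squared power_divide norm_add_squared g.scaleR g.add
          cinner_scaleR_left cinner_scaleR_right field_simps)
    with m_le[of "(1/2) *\<^sub>R (x + y)"] show ?thesis by simp
  qed
  have "\<exists>x. J x < m + 1 / real (Suc n)" for n
    using cInf_lessD[of "range J" "m + 1 / real (Suc n)"] by (auto simp: m_def)
  then obtain u where u: "\<And>n. J (u n) < m + 1 / real (Suc n)"
    by metis
  have Ju: "(\<lambda>n. J (u n)) \<longlonglongrightarrow> m"
  proof (rule tendsto_sandwich[OF _ _ tendsto_const])
    show "(\<lambda>n. m + 1 / real (Suc n)) \<longlonglongrightarrow> m"
      using tendsto_add[OF tendsto_const LIMSEQ_inverse_real_of_nat, of m]
      by (simp add: inverse_eq_divide)
  qed (use m_le u in \<open>auto intro!: always_eventually simp: less_imp_le\<close>)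
  have "Cauchy u"
  proof (rule CauchyI)
    fix e :: real
    assume e: "0 < e"
    then have "\<forall>\<^sub>F n in sequentially. J (u n) < m + e\<^sup>2 / 4"
      by (intro order_tendstoD(2)[OF Ju]) simp
    then obtain N where N: "\<And>n. n \<ge> N \<Longrightarrow> J (u n) < m + e\<^sup>2 / 4"
      by (auto simp: eventually_sequentially)
    have "norm (u i - u j) < e" if "i \<ge> N" "j \<ge> N" for i j
    proof (rule power2_less_imp_less)
      show "(norm (u i - u j))\<^sup>2 < e\<^sup>2"
        using close[of "u i" "u j"] N[OF that(1)] N[OF that(2)] by simp
    qed (use e in simp)
    then show "\<exists>N. \<forall>i\<ge>N. \<forall>j\<ge>N. norm (u i - u j) < e" by blast
  qed
  then obtain z where z: "u \<longlonglongrightarrow> z"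
    using Cauchy_convergent convergent_def by blast
  have "(\<lambda>n. J (u n)) \<longlonglongrightarrow> J z"
    unfolding J_def by (intro tendsto_intros z g.tendsto)
  then have Jz: "J z = m"
    using Ju LIMSEQ_unique by blast
  have "g x = Re (cinner x z)" for x
  proof -
    define a where "a = Re (cinner x z) - g x"
    \<comment> \<open>The increment of \<open>J\<close> along \<open>x\<close> is minimal at \<open>t = - a / (norm x)\<^sup>2\<close>; enlarging the
      denominator covers \<open>x = 0\<close> and keeps the increment negative unless \<open>a = 0\<close>.\<close>
    define N where "N = (norm x)\<^sup>2 + 1"
    have N: "N > 0" by (simp add: N_def add_nonneg_pos)
    define t where "t = - a / N"
    have "J z \<le> J (z + t *\<^sub>R x)"
      using Jz m_le by simp
    then have "0 \<le> t\<^sup>2 * (norm x)\<^sup>2 + 2 * t * a"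
      using Re_cinner_commute[of x z]
      by (simp add: J_def a_def norm_add_squared g.add g.scaleR cinner_scaleR_right
          power_mult_distrib algebra_simps)
    also have "\<dots> \<le> t\<^sup>2 * N + 2 * t * a"
      by (simp add: N_def algebra_simps)
    also have "\<dots> = - (a\<^sup>2 / N)"
      using N by (simp add: t_def power2_eq_square field_simps)
    finally have "a\<^sup>2 / N \<le> 0" by simp
    then have "a = 0"
      using N by (simp add: divide_le_0_iff)
    then show ?thesis by (simp add: a_def)
  qed
  then show ?thesis by blast
qed

lemma adjoint_exists:
  fixes A :: "'a::chilbert_space \<Rightarrow> 'a"
  assumes A: "bounded_clinear A"
  shows "\<exists>B. bounded_clinear B \<and> (\<forall>x y. cinner (A x) y = cinner x (B y))"
proof -
  have "\<exists>z. \<forall>x. Re (cinner (A x) y) = Re (cinner x z)" for y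
    by (rule Riesz_representation_Re)
      (rule bounded_linear_compose[OF bounded_linear_Re_cinner_left
          bounded_clinear_bounded_linear[OF A]])
  then obtain B where B: "\<And>x y. Re (cinner (A x) y) = Re (cinner x (B y))"
    by metis
  have adj: "cinner (A x) y = cinner x (B y)" for x y
    using bounded_clinear_scaleC[OF A] B by (rule adjoint_from_Re)
  obtain K where K: "\<And>x. norm (A x) \<le> norm x * K" and K0: "K \<ge> 0"
    using bounded_linear.nonneg_bounded[OF bounded_clinear_bounded_linear[OF A]] by blast
  have "bounded_clinear B"
  proof (rule bounded_clinearI)
    show "B (x + y) = B x + B y" for x y
      by (rule Re_cinner_ext) (simp add: cinner_add_right flip: adj)
    show "B (c *\<^sub>C x) = c *\<^sub>C B x" for c x
      by (rule Re_cinner_ext) (simp add: cinner_scaleC_right flip: adj)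
    show "norm (B y) \<le> norm y * K" for y
    proof -
      have "(norm (B y))\<^sup>2 = Re (cinner (A (B y)) y)"
        by (simp add: norm_squared_cinner adj)
      also have "\<dots> \<le> norm (A (B y)) * norm y" by (rule Re_cinner_le)
      also have "\<dots> \<le> norm (B y) * K * norm y"
        by (intro mult_right_mono K) simp
      finally have "norm (B y) * norm (B y) \<le> norm (B y) * (norm y * K)"
        by (simp add: power2_eq_square ac_simps)
      then show ?thesis
        using K0 by (cases "B y = 0") auto
    qed
  qed
  with adj show ?thesis by blast
qed

lemma cadjoint_eqI:
  assumes "bounded_clinear B" and "\<And>x y. cinner (A x) y = cinner x (B y)"
  shows "cadjoint A = B"
  unfolding cadjoint_def
proof (rule the_equality)
  fix C
  assume "bounded_clinear C \<and> (\<forall>x y. cinner (A x) y = cinner x (C y))"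
  then have C: "\<And>x y. cinner (A x) y = cinner x (C y)" by blast
  show "C = B"
    by (rule ext, rule Re_cinner_ext) (simp flip: assms(2) C)
qed (use assms in blast)

lemma bounded_clinear_cadjoint: "bounded_clinear A \<Longrightarrow> bounded_clinear (cadjoint A)"
  and cinner_cadjoint_right: "bounded_clinear A \<Longrightarrow> cinner (A x) y = cinner x (cadjoint A y)"
  using adjoint_exists[of A] cadjoint_eqI[of _ A] by blast+

lemma cinner_cadjoint_left:
  "bounded_clinear A \<Longrightarrow> cinner (cadjoint A x) y = cinner x (A y)"
  by (subst (1 2) cinner_commute) (simp add: cinner_cadjoint_right)

lemma cadjoint_cadjoint: "bounded_clinear A \<Longrightarrow> cadjoint (cadjoint A) = A"
  by (intro cadjoint_eqI) (simp_all add: cinner_cadjoint_left)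

lemma cadjoint_mult:
  "bounded_clinear A \<Longrightarrow> bounded_clinear B \<Longrightarrow>
    cadjoint (\<lambda>x. A (B x)) = (\<lambda>x. cadjoint B (cadjoint A x))"
  by (intro cadjoint_eqI)
    (simp_all add: cinner_cadjoint_right bounded_clinear_compose bounded_clinear_cadjoint)

lemma cadjoint_sum:
  "bounded_clinear A \<Longrightarrow> bounded_clinear B \<Longrightarrow>
    cadjoint (\<lambda>x. A x + B x) = (\<lambda>x. cadjoint A x + cadjoint B x)"
  by (intro cadjoint_eqI)
    (simp_all add: cinner_simps cinner_cadjoint_right bounded_clinear_sum
      bounded_clinear_cadjoint)

lemma cadjoint_scaled:
  "bounded_clinear A \<Longrightarrow> cadjoint (\<lambda>x. r *\<^sub>R A x) = (\<lambda>x. r *\<^sub>R cadjoint A x)"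
  by (intro cadjoint_eqI)
    (simp_all add: cinner_simps cinner_cadjoint_right bounded_clinear_scaled
      bounded_clinear_cadjoint)


section \<open>Positive operators and their square roots\<close>

lemma positive_op_iff:
  "positive_op A \<longleftrightarrow> bounded_clinear A \<and> (\<forall>x. Im (cinner (A x) x) = 0 \<and> 0 \<le> Re (cinner (A x) x))"
  by (auto simp: positive_op_def complex_nonneg_Reals_iff)

lemma positive_op_bounded_clinear: "positive_op A \<Longrightarrow> bounded_clinear A"
  and positive_op_Re_nonneg: "positive_op A \<Longrightarrow> 0 \<le> Re (cinner (A x) x)"
  by (auto simp: positive_op_iff)

text \<open>Polarization: the form is real at \<open>x + y\<close> and at \<open>x + \<i> y\<close>.\<close>

lemma positive_op_symmetric:
  assumes A: "positive_op A"
  shows "cinner (A x) y = cinner x (A y)"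
proof (rule adjoint_from_Re)
  note lin = positive_op_bounded_clinear[OF A]
  show "A (c *\<^sub>C x) = c *\<^sub>C A x" for c x
    by (rule bounded_clinear_scaleC[OF lin])
  have im: "Im (cinner (A x) x) = 0" for x
    using A by (simp add: positive_op_iff)
  have "Im (cinner (A x) y) + Im (cinner (A y) x) = 0" for x y
    using im[of "x + y"] im[of x] im[of y]
    by (simp add: bounded_clinear_add[OF lin] cinner_simps)
  from this[of _ "\<i> *\<^sub>C _"] show "Re (cinner (A x) y) = Re (cinner x (A y))" for x y
    using Re_cinner_commute[of "A y" x]
    by (simp add: bounded_clinear_scaleC[OF lin] cinner_scaleC_left cinner_scaleC_right)
qed

lemma symmetric_positive_opI:
  assumes "bounded_clinear A" and "\<And>x y. cinner (A x) y = cinner x (A y)"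
    and "\<And>x. 0 \<le> Re (cinner (A x) x)"
  shows "positive_op A"
proof -
  have "Im (cinner (A x) x) = 0" for x
  proof -
    have "cinner (A x) x = cnj (cinner (A x) x)"
      using assms(2)[of x x] cinner_commute[of x "A x"] by simp
    then show ?thesis by (simp add: complex_eq_iff)
  qed
  with assms show ?thesis by (simp add: positive_op_iff)
qed

lemma cadjoint_positive_op: "positive_op A \<Longrightarrow> cadjoint A = A"
  by (simp add: cadjoint_eqI positive_op_bounded_clinear positive_op_symmetric)

text \<open>This is the operator inequality \<open>A\<^sup>2 \<le> K A\<close>, obtained from positivity of the form at the
  single vector \<open>x - (1/K) A x\<close>. It plays the part of the Cauchy-Schwarz inequality of the
  semi-inner product defined by \<open>A\<close>.\<close>

lemma positive_op_norm_squared_le: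
  assumes A: "positive_op A" and K: "K > 0" and bd: "\<And>x. norm (A x) \<le> K * norm x"
  shows "(norm (A x))\<^sup>2 \<le> K * Re (cinner (A x) x)"
proof -
  note lin = positive_op_bounded_clinear[OF A]
  define N where "N = (norm (A x))\<^sup>2"
  have "Re (cinner (A (A x)) (A x)) \<le> norm (A (A x)) * norm (A x)"
    by (rule Re_cinner_le)
  also have "\<dots> \<le> K * norm (A x) * norm (A x)"
    by (intro mult_right_mono bd) simp
  finally have le: "Re (cinner (A (A x)) (A x)) \<le> K * N"
    by (simp add: N_def power2_eq_square)
  have sym: "Re (cinner (A (A x)) x) = N"
    by (simp add: positive_op_symmetric[OF A] N_def norm_squared_cinner)
  define q where "q = Re (cinner (A x) x)"
  define r where "r = Re (cinner (A (A x)) (A x))"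
  have "0 \<le> Re (cinner (A (x - (1/K) *\<^sub>R A x)) (x - (1/K) *\<^sub>R A x))"
    by (rule positive_op_Re_nonneg[OF A])
  also have "\<dots> = q - 2 * N / K + r / K\<^sup>2"
    using sym K
    by (simp add: bounded_clinear_simps[OF lin] cinner_simps q_def r_def
        norm_squared_cinner[of "A x", folded N_def] power2_eq_square field_simps)
  also have "\<dots> \<le> q - 2 * N / K + (K * N) / K\<^sup>2"
    using le K by (simp add: r_def divide_right_mono)
  also have "\<dots> = q - N / K"
    using K by (simp add: power2_eq_square field_simps)
  finally show ?thesis
    using K by (simp add: q_def N_def field_simps)
qed

lemma positive_op_bound:
  assumes "positive_op A"
  shows "\<exists>K>0. \<forall>x. norm (A x) \<le> K * norm x"
  using bounded_linear.pos_bounded[OF bounded_clinear_bounded_linear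
      [OF positive_op_bounded_clinear[OF assms]]]
  by (metis mult.commute)

lemma positive_op_null_vector:
  assumes A: "positive_op A" and "Re (cinner (A x) x) = 0"
  shows "A x = 0"
proof -
  obtain K where "K > 0" "\<And>x. norm (A x) \<le> K * norm x"
    using positive_op_bound[OF A] by blast
  from positive_op_norm_squared_le[OF A this, of x] assms(2) show ?thesis
    by simp
qed

text \<open>A square root of \<open>1 - X\<close> is \<open>1 - Y\<close> with \<open>Y = (X + Y\<^sup>2) / 2\<close>, which suggests to iterate. The
  same recursion for the scalar \<open>X = 1\<close> increases to a limit and dominates the operator recursion
  for every contraction \<open>X\<close>, also at the critical norm \<open>1\<close> where the recursion is no contraction
  mapping.\<close>

primrec sqrt_iter :: "('a::real_vector \<Rightarrow> 'a) \<Rightarrow> nat \<Rightarrow> 'a \<Rightarrow> 'a" where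
  "sqrt_iter X 0 = (\<lambda>x. 0)"
| "sqrt_iter X (Suc n) = (\<lambda>x. (1/2) *\<^sub>R (X x + sqrt_iter X n (sqrt_iter X n x)))"

primrec sqrt_majorant :: "nat \<Rightarrow> real" where
  "sqrt_majorant 0 = 0"
| "sqrt_majorant (Suc n) = (1 + (sqrt_majorant n)\<^sup>2) / 2"

lemma sqrt_majorant_bounds: "0 \<le> sqrt_majorant n" "sqrt_majorant n \<le> 1"
  by (induction n) (simp_all add: power_le_one)

lemma sqrt_majorant_mono: "sqrt_majorant n \<le> sqrt_majorant (Suc n)"
proof -
  have "0 \<le> (1 - sqrt_majorant n)\<^sup>2" by simp
  then show ?thesis by (simp add: power2_diff)
qed

lemma Cauchy_sqrt_majorant: "Cauchy sqrt_majorant"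
proof (rule convergent_Cauchy, rule Bseq_mono_convergent)
  show "Bseq sqrt_majorant"
    by (rule BseqI'[of _ 1]) (simp add: sqrt_majorant_bounds)
  show "\<forall>m n. m \<le> n \<longrightarrow> sqrt_majorant m \<le> sqrt_majorant n"
    using lift_Suc_mono_le[of sqrt_majorant] sqrt_majorant_mono by blast
qed

lemma bounded_linear_sqrt_iter:
  "bounded_linear X \<Longrightarrow> bounded_linear (sqrt_iter X n)"
  by (induction n)
    (simp_all add: bounded_linear_zero bounded_linear_const_scaleR bounded_linear_add
      bounded_linear_compose)

lemma bounded_clinear_sqrt_iter:
  "bounded_clinear X \<Longrightarrow> bounded_clinear (sqrt_iter X n)"
proof (induction n)
  case 0
  show ?case
    by (rule bounded_clinearI[where K = 0])
      (simp_all add: scaleC_diff_right[of _ 0 0, simplified])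
next
  case (Suc n)
  then show ?case by (simp add: bounded_clinear_intros bounded_clinear_compose)
qed

lemma sqrt_iter_commute:
  assumes "bounded_linear C" and "\<And>x. C (X x) = X (C x)"
  shows "C (sqrt_iter X n x) = sqrt_iter X n (C x)"
proof (induction n arbitrary: x)
  case (Suc n)
  then show ?case
    using assms by (simp add: linear_simps)
qed (use assms in \<open>simp add: linear_simps\<close>)

lemma sqrt_iter_symmetric:
  fixes X :: "'a::complex_inner \<Rightarrow> 'a"
  assumes "\<And>x y. cinner (X x) y = cinner x (X y)"
  shows "cinner (sqrt_iter X n x) y = cinner x (sqrt_iter X n y)"
proof (induction n arbitrary: x y)
  case (Suc n)
  then show ?case by (simp add: assms cinner_simps)
qed simp

lemma norm_sqrt_iter:
  fixes X :: "'a::real_normed_vector \<Rightarrow> 'a"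
  assumes "\<And>x. norm (X x) \<le> norm x"
  shows "norm (sqrt_iter X n x) \<le> sqrt_majorant n * norm x"
proof (induction n arbitrary: x)
  case (Suc n)
  let ?Y = "sqrt_iter X n" and ?s = "sqrt_majorant n"
  have "norm (?Y (?Y x)) \<le> ?s * norm (?Y x)" by (rule Suc)
  also have "\<dots> \<le> ?s * (?s * norm x)"
    by (intro mult_left_mono Suc sqrt_majorant_bounds)
  finally have "norm (X x + ?Y (?Y x)) \<le> norm x + ?s * (?s * norm x)"
    using assms[of x] norm_triangle_ineq[of "X x" "?Y (?Y x)"] by linarith
  then show ?case by (simp add: power2_eq_square distrib_right mult.assoc)
qed simp

text \<open>The increments are compared through \<open>Y\<^sup>2 - Z\<^sup>2 = Y (Y - Z) + (Y - Z) Z\<close>; for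
  the scalar majorants \<open>t\<close> and \<open>s\<close> the same expression is \<open>t\<^sup>2 - s\<^sup>2\<close>.\<close>

lemma norm_sqrt_iter_Suc_diff:
  fixes X :: "'a::real_normed_vector \<Rightarrow> 'a"
  assumes lin: "bounded_linear X" and bd: "\<And>x. norm (X x) \<le> norm x"
  shows "norm (sqrt_iter X (Suc n) x - sqrt_iter X n x)
    \<le> (sqrt_majorant (Suc n) - sqrt_majorant n) * norm x"
proof (induction n arbitrary: x)
  case 0
  show ?case using bd[of x] by simp
next
  case (Suc n)
  let ?Z = "sqrt_iter X n" and ?Y = "sqrt_iter X (Suc n)"
  let ?s = "sqrt_majorant n" and ?t = "sqrt_majorant (Suc n)"
  have st: "0 \<le> ?t - ?s" "0 \<le> ?t" "0 \<le> ?s"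
    using sqrt_majorant_mono[of n] sqrt_majorant_bounds(1) by (simp_all del: sqrt_majorant.simps)
  have "norm (?Y (?Y x - ?Z x)) \<le> ?t * norm (?Y x - ?Z x)"
    by (rule norm_sqrt_iter[OF bd])
  also have "\<dots> \<le> ?t * ((?t - ?s) * norm x)"
    by (intro mult_left_mono Suc st)
  finally have 1: "norm (?Y (?Y x - ?Z x)) \<le> ?t * ((?t - ?s) * norm x)" .
  have "norm (?Y (?Z x) - ?Z (?Z x)) \<le> (?t - ?s) * norm (?Z x)"
    by (rule Suc)
  also have "\<dots> \<le> (?t - ?s) * (?s * norm x)"
    by (intro mult_left_mono norm_sqrt_iter[OF bd] st)
  finally have 2: "norm (?Y (?Z x) - ?Z (?Z x)) \<le> (?t - ?s) * (?s * norm x)" .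
  have "sqrt_iter X (Suc (Suc n)) x - ?Y x = (1/2) *\<^sub>R (?Y (?Y x) - ?Z (?Z x))"
    unfolding sqrt_iter.simps(2)[of X "Suc n"] sqrt_iter.simps(2)[of X n, THEN fun_cong, of x]
    by (simp add: algebra_simps del: sqrt_iter.simps)
  also have "?Y (?Y x) - ?Z (?Z x) = ?Y (?Y x - ?Z x) + (?Y (?Z x) - ?Z (?Z x))"
    by (simp add: linear_simps[OF bounded_linear_sqrt_iter[OF lin]] del: sqrt_iter.simps)
  finally have "norm (sqrt_iter X (Suc (Suc n)) x - ?Y x)
      = (1/2) * norm (?Y (?Y x - ?Z x) + (?Y (?Z x) - ?Z (?Z x)))"
    by (simp del: sqrt_iter.simps)
  also have "\<dots> \<le> (1/2) * (?t * ((?t - ?s) * norm x) + (?t - ?s) * (?s * norm x))"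
    by (intro mult_left_mono order_trans[OF norm_triangle_ineq add_mono[OF 1 2]]) simp
  also have "\<dots> = ((1 + ?t\<^sup>2) / 2 - (1 + ?s\<^sup>2) / 2) * norm x"
    by (simp add: power2_eq_square field_simps del: sqrt_majorant.simps)
  also have "\<dots> = (sqrt_majorant (Suc (Suc n)) - ?t) * norm x"
    by simp
  finally show ?case .
qed

lemma norm_sqrt_iter_diff:
  fixes X :: "'a::real_normed_vector \<Rightarrow> 'a"
  assumes "bounded_linear X" and "\<And>x. norm (X x) \<le> norm x"
  shows "norm (sqrt_iter X (n + k) x - sqrt_iter X n x)
    \<le> (sqrt_majorant (n + k) - sqrt_majorant n) * norm x"
proof (induction k)
  case (Suc k)
  have "norm (sqrt_iter X (n + Suc k) x - sqrt_iter X n x)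
      \<le> norm (sqrt_iter X (Suc (n + k)) x - sqrt_iter X (n + k) x)
        + norm (sqrt_iter X (n + k) x - sqrt_iter X n x)"
    using norm_triangle_ineq[of "sqrt_iter X (Suc (n + k)) x - sqrt_iter X (n + k) x"
        "sqrt_iter X (n + k) x - sqrt_iter X n x"]
    by (simp del: sqrt_iter.simps)
  also have "\<dots> \<le> (sqrt_majorant (Suc (n + k)) - sqrt_majorant (n + k)) * norm x
      + (sqrt_majorant (n + k) - sqrt_majorant n) * norm x"
    by (intro add_mono Suc norm_sqrt_iter_Suc_diff assms)
  finally show ?case
    by (simp add: algebra_simps del: sqrt_iter.simps sqrt_majorant.simps)
qed simp

lemma convergent_sqrt_iter:
  fixes X :: "'a::chilbert_space \<Rightarrow> 'a"
  assumes X: "bounded_linear X" "\<And>x. norm (X x) \<le> norm x"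
  shows "convergent (\<lambda>n. sqrt_iter X n x)"
proof (rule Cauchy_convergent, rule CauchyI)
  fix e :: real
  assume e: "0 < e"
  define d where "d = e / (norm x + 1)"
  have pos: "norm x + 1 > 0" by (simp add: add_nonneg_pos)
  with e have "0 < d" by (simp add: d_def)
  then obtain N where N: "\<And>i j. i \<ge> N \<Longrightarrow> j \<ge> N \<Longrightarrow> norm (sqrt_majorant i - sqrt_majorant j) < d"
    using CauchyD[OF Cauchy_sqrt_majorant] by blast
  have less: "norm (sqrt_iter X i x - sqrt_iter X j x) < e" if "j \<ge> N" "i \<ge> j" for i j
  proof -
    have "norm (sqrt_iter X i x - sqrt_iter X j x) \<le> (sqrt_majorant i - sqrt_majorant j) * norm x"
      using norm_sqrt_iter_diff[OF X, of j "i - j" x] that by simp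
    also have "\<dots> \<le> d * norm x"
      using N[of i j] that by (intro mult_right_mono) auto
    also have "\<dots> < d * (norm x + 1)"
      using \<open>0 < d\<close> by simp
    also have "\<dots> = e"
      using pos by (simp add: d_def)
    finally show ?thesis .
  qed
  have "norm (sqrt_iter X i x - sqrt_iter X j x) < e" if "i \<ge> N" "j \<ge> N" for i j
    using less[of j i] less[of i j] that by (cases "i \<ge> j") (auto simp: norm_minus_commute)
  then show "\<exists>N. \<forall>i\<ge>N. \<forall>j\<ge>N. norm (sqrt_iter X i x - sqrt_iter X j x) < e" by blast
qed

text \<open>The commutation clause records that \<open>Y\<close> is a strong limit of polynomials in \<open>X\<close>; uniqueness
  of square roots rests on it.\<close>

lemma contraction_quadratic_fixpoint:
  fixes X :: "'a::chilbert_space \<Rightarrow> 'a"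
  assumes X: "bounded_clinear X" "\<And>x. norm (X x) \<le> norm x"
    and sym: "\<And>x y. cinner (X x) y = cinner x (X y)"
  obtains Y where "bounded_clinear Y" "\<And>x. norm (Y x) \<le> norm x"
    "\<And>x y. cinner (Y x) y = cinner x (Y y)"
    "\<And>x. Y x = (1/2) *\<^sub>R (X x + Y (Y x))"
    "\<And>C x. bounded_linear C \<Longrightarrow> (\<And>x. C (X x) = X (C x)) \<Longrightarrow> C (Y x) = Y (C x)"
proof -
  note linX = bounded_clinear_bounded_linear[OF X(1)]
  define Y where "Y x = lim (\<lambda>n. sqrt_iter X n x)" for x
  have Y: "(\<lambda>n. sqrt_iter X n x) \<longlonglongrightarrow> Y x" for x
    using convergent_sqrt_iter[OF linX X(2)] by (simp add: Y_def convergent_LIMSEQ_iff)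
  note iter_lin = bounded_clinear_sqrt_iter[OF X(1)]
  have iter_bd: "norm (sqrt_iter X n x) \<le> norm x" for n x
    using order_trans[OF norm_sqrt_iter[OF X(2)] mult_right_mono[OF sqrt_majorant_bounds(2)]]
    by simp
  have bd: "norm (Y x) \<le> norm x" for x
    by (rule LIMSEQ_le_const2[OF tendsto_norm[OF Y]]) (use iter_bd in blast)
  have add: "Y (x + y) = Y x + Y y" for x y
    using LIMSEQ_unique[OF Y[of "x + y"]] tendsto_add[OF Y[of x] Y[of y]]
    by (simp add: bounded_clinear_add[OF iter_lin])
  have scale: "Y (c *\<^sub>C x) = c *\<^sub>C Y x" for c x
  proof -
    have "bounded_linear (\<lambda>x::'a. c *\<^sub>C x)"
      by (rule bounded_linear_intro[where K = "cmod c"])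
        (simp_all add: scaleC_add_right scaleC_scaleR_commute norm_scaleC mult.commute)
    from bounded_linear.tendsto[OF this Y, of x] show ?thesis
      using LIMSEQ_unique[OF Y[of "c *\<^sub>C x"]] by (simp add: bounded_clinear_scaleC[OF iter_lin])
  qed
  have lin: "bounded_clinear Y"
    by (rule bounded_clinearI[where K = 1]) (simp_all add: add scale bd)
  have "(\<lambda>n. Re (cinner (sqrt_iter X n x) y)) \<longlonglongrightarrow> Re (cinner x (Y y))" for x y
    unfolding sqrt_iter_symmetric[OF sym]
    by (rule bounded_linear.tendsto[OF bounded_linear_Re_cinner_right Y])
  then have "Re (cinner (Y x) y) = Re (cinner x (Y y))" for x y
    using LIMSEQ_unique bounded_linear.tendsto[OF bounded_linear_Re_cinner_left Y] by blast
  with scale have symY: "cinner (Y x) y = cinner x (Y y)" for x y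
    by (rule adjoint_from_Re)
  have twice: "(\<lambda>n. sqrt_iter X n (sqrt_iter X n x)) \<longlonglongrightarrow> Y (Y x)" for x
  proof -
    have "(\<lambda>n. sqrt_iter X n (sqrt_iter X n x - Y x)) \<longlonglongrightarrow> 0"
    proof (rule Lim_null_comparison)
      show "\<forall>\<^sub>F n in sequentially.
          norm (sqrt_iter X n (sqrt_iter X n x - Y x)) \<le> norm (sqrt_iter X n x - Y x)"
        by (simp add: iter_bd)
      show "(\<lambda>n. norm (sqrt_iter X n x - Y x)) \<longlonglongrightarrow> 0"
        using Y[of x] by (simp add: LIM_zero_iff tendsto_norm_zero_iff)
    qed
    from tendsto_add[OF this Y[of "Y x"]] show ?thesis
      by (simp add: bounded_clinear_diff[OF iter_lin])
  qed
  have "(\<lambda>n. sqrt_iter X (Suc n) x) \<longlonglongrightarrow> (1/2) *\<^sub>R (X x + Y (Y x))" for x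
    unfolding sqrt_iter.simps by (intro tendsto_intros twice)
  then have fix_eq: "Y x = (1/2) *\<^sub>R (X x + Y (Y x))" for x
    using LIMSEQ_unique LIMSEQ_Suc[OF Y] by blast
  have "C (Y x) = Y (C x)" if C: "bounded_linear C" "\<And>x. C (X x) = X (C x)" for C x
    using LIMSEQ_unique[OF _ Y[of "C x"]] bounded_linear.tendsto[OF C(1) Y[of x]]
    by (simp add: sqrt_iter_commute[where C = C and X = X, OF C])
  with that[OF lin bd symY fix_eq] show ?thesis by blast
qed

text \<open>After scaling, \<open>0 \<le> A \<le> 1\<close>, and then \<open>1 - A\<close> is a contraction.\<close>

lemma positive_sqrt_exists:
  fixes A :: "'a::chilbert_space \<Rightarrow> 'a"
  assumes A: "positive_op A"
  shows "\<exists>S. positive_op S \<and> (\<forall>x. S (S x) = A x) \<and>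
    (\<forall>C. bounded_linear C \<longrightarrow> (\<forall>x. C (A x) = A (C x)) \<longrightarrow> (\<forall>x. C (S x) = S (C x)))"
proof -
  note linA = positive_op_bounded_clinear[OF A]
  obtain K where K: "K > 0" "\<And>x. norm (A x) \<le> K * norm x"
    using positive_op_bound[OF A] by blast
  define X where "X x = x - (1/K) *\<^sub>R A x" for x
  have linX: "bounded_clinear X"
    unfolding X_def by (intro bounded_clinear_intros linA)
  have symX: "cinner (X x) y = cinner x (X y)" for x y
    by (simp add: X_def cinner_simps positive_op_symmetric[OF A])
  have "norm (X x) \<le> norm x" for x
  proof (rule power2_le_imp_le)
    define q where "q = Re (cinner (A x) x)"
    have "(norm (X x))\<^sup>2 = (norm x)\<^sup>2 - 2 * q / K + (norm (A x))\<^sup>2 / K\<^sup>2"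
      using Re_cinner_commute[of x "A x"] K(1)
      by (simp add: X_def norm_diff_squared cinner_scaleR_right q_def power_divide)
    also have "\<dots> \<le> (norm x)\<^sup>2 - 2 * q / K + K * q / K\<^sup>2"
      using positive_op_norm_squared_le[OF A K, of x]
      by (simp add: q_def divide_right_mono)
    also have "\<dots> = (norm x)\<^sup>2 - q / K"
      using K(1) by (simp add: power2_eq_square field_simps)
    also have "\<dots> \<le> (norm x)\<^sup>2"
      using positive_op_Re_nonneg[OF A, of x] K(1) by (simp add: q_def)
    finally show "(norm (X x))\<^sup>2 \<le> (norm x)\<^sup>2" .
  qed simp
  from contraction_quadratic_fixpoint[OF linX this symX] obtain Y where
    linY: "bounded_clinear Y" and bdY: "\<And>x. norm (Y x) \<le> norm x"
    and symY: "\<And>x y. cinner (Y x) y = cinner x (Y y)"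
    and fix_eq: "\<And>x. Y x = (1/2) *\<^sub>R (X x + Y (Y x))"
    and comm: "\<And>C x. bounded_linear C \<Longrightarrow> (\<And>x. C (X x) = X (C x)) \<Longrightarrow> C (Y x) = Y (C x)"
    by blast
  define S where "S x = sqrt K *\<^sub>R (x - Y x)" for x
  have "positive_op S"
  proof (rule symmetric_positive_opI)
    show "bounded_clinear S"
      unfolding S_def by (intro bounded_clinear_intros linY)
    show "cinner (S x) y = cinner x (S y)" for x y
      by (simp add: S_def cinner_simps symY)
    show "0 \<le> Re (cinner (S x) x)" for x
    proof -
      have "Re (cinner (Y x) x) \<le> norm x * norm x"
        using Re_cinner_le[of "Y x" x] mult_right_mono[OF bdY[of x], of "norm x"] by simp
      then show ?thesis
        using K(1) by (simp add: S_def cinner_simps power2_eq_square flip: norm_squared_cinner)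
    qed
  qed
  moreover have "S (S x) = A x" for x
  proof -
    have "S (S x) = K *\<^sub>R (x - 2 *\<^sub>R Y x + Y (Y x))"
      using K(1)
      by (simp add: S_def bounded_clinear_simps[OF linY] algebra_simps scaleR_2)
    also have "2 *\<^sub>R Y x = X x + Y (Y x)"
      by (subst fix_eq) simp
    finally show ?thesis
      using K(1) by (simp add: X_def algebra_simps)
  qed
  moreover have "C (S x) = S (C x)" if C: "bounded_linear C" "\<And>x. C (A x) = A (C x)" for C x
  proof -
    have "C (Y x) = Y (C x)"
      by (rule comm[OF C(1)]) (simp add: X_def linear_simps[OF C(1)] C(2))
    then show ?thesis
      by (simp add: S_def linear_simps[OF C(1)])
  qed
  ultimately show ?thesis by blast
qed

text \<open>The root produced by the iteration commutes with every root \<open>B\<close>, since \<open>B\<close> commutes with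
  \<open>B\<^sup>2\<close>. Hence \<open>(B + S) (B - S) = 0\<close>, and as \<open>B\<close> and \<open>S\<close> are positive each of them kills the
  range of \<open>B - S\<close>, so that \<open>(B - S)\<^sup>2 = 0\<close>.\<close>

lemma positive_sqrt_unique:
  fixes B C :: "'a::chilbert_space \<Rightarrow> 'a"
  assumes B: "positive_op B" and C: "positive_op C" and eq: "\<And>x. B (B x) = C (C x)"
  shows "B = C"
proof -
  have "positive_op (\<lambda>x. B (B x))"
  proof (rule symmetric_positive_opI)
    show "bounded_clinear (\<lambda>x. B (B x))"
      by (intro bounded_clinear_compose[OF positive_op_bounded_clinear[OF B]]
          positive_op_bounded_clinear[OF B])
    show "cinner (B (B x)) y = cinner x (B (B y))" for x y
      by (simp add: positive_op_symmetric[OF B])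
    show "0 \<le> Re (cinner (B (B x)) x)" for x
      unfolding positive_op_symmetric[OF B, of "B x"] by (simp flip: norm_squared_cinner)
  qed
  from positive_sqrt_exists[OF this] obtain S where S: "positive_op S"
    and SS: "\<And>x. S (S x) = B (B x)"
    and comm: "\<And>C x. bounded_linear C \<Longrightarrow> (\<And>x. C (B (B x)) = B (B (C x))) \<Longrightarrow> C (S x) = S (C x)"
    by blast
  have eq_S: "R = S" if R: "positive_op R" and RR: "\<And>x. R (R x) = B (B x)" for R
  proof
    fix x
    note linR = positive_op_bounded_clinear[OF R] and linS = positive_op_bounded_clinear[OF S]
    have RS: "R (S x) = S (R x)"
      by (rule comm) (simp_all add: bounded_clinear_bounded_linear linR flip: RR)
    define y where "y = R x - S x"
    have "R y + S y = 0"
      by (simp add: y_def bounded_clinear_diff[OF linR] bounded_clinear_diff[OF linS] RS RR SS)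
    then have "Re (cinner (R y) y) + Re (cinner (S y) y) = 0"
      by (simp flip: cinner_add_left plus_complex.sel)
    then have "Re (cinner (R y) y) = 0" "Re (cinner (S y) y) = 0"
      using positive_op_Re_nonneg[OF R, of y] positive_op_Re_nonneg[OF S, of y] by linarith+
    then have "R y = 0" "S y = 0"
      using positive_op_null_vector R S by blast+
    then have "(norm y)\<^sup>2 = 0"
      unfolding norm_squared_cinner
      by (subst y_def) (simp add: cinner_diff_left positive_op_symmetric[OF R]
          positive_op_symmetric[OF S])
    then show "R x = S x" by (simp add: y_def)
  qed
  show ?thesis
    using eq_S[OF B] eq_S[OF C] eq by simp
qed

lemma sqrt_op_eqI:
  assumes "positive_op B" and "\<And>x. B (B x) = A x"
  shows "sqrt_op A = B"
  unfolding sqrt_op_def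
proof (rule the_equality)
  show "C = B" if "positive_op C \<and> C \<circ> C = A" for C
    by (rule positive_sqrt_unique) (use that assms in \<open>auto simp: fun_eq_iff\<close>)
qed (use assms in auto)

lemma abs_op_eqI:
  assumes "positive_op Q" and "\<And>x. Q (Q x) = cadjoint A (A x)"
  shows "abs_op A = Q"
  using assms by (simp add: abs_op_def sqrt_op_eqI)

lemma positive_op_abs_op: "bounded_clinear A \<Longrightarrow> positive_op (abs_op A)"
  and abs_op_abs_op: "bounded_clinear A \<Longrightarrow> abs_op A (abs_op A x) = cadjoint A (A x)"
proof -
  assume A: "bounded_clinear A"
  have "positive_op (\<lambda>x. cadjoint A (A x))"
  proof (rule symmetric_positive_opI)
    show "bounded_clinear (\<lambda>x. cadjoint A (A x))"
      by (rule bounded_clinear_compose[OF bounded_clinear_cadjoint[OF A] A])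
    show "0 \<le> Re (cinner (cadjoint A (A x)) x)" for x
      by (simp add: cinner_cadjoint_left[OF A] flip: norm_squared_cinner)
  qed (simp add: cinner_cadjoint_left[OF A] flip: cinner_cadjoint_right[OF A])
  from positive_sqrt_exists[OF this]
  obtain S where S: "positive_op S" "\<And>x. S (S x) = cadjoint A (A x)"
    by blast
  with abs_op_eqI[OF S] show "positive_op (abs_op A)"
    "abs_op A (abs_op A x) = cadjoint A (A x)" by simp_all
qed

lemma op_ker_abs_op:
  assumes A: "bounded_clinear A"
  shows "op_ker (abs_op A) = op_ker A"
proof -
  have "(norm (abs_op A x))\<^sup>2 = (norm (A x))\<^sup>2" for x
    by (simp add: norm_squared_cinner positive_op_symmetric[OF positive_op_abs_op[OF A]]
        abs_op_abs_op[OF A] cinner_cadjoint_right[OF A])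
  then have "norm (abs_op A x) = norm (A x)" for x
    by (simp add: power2_eq_iff_nonneg)
  then show ?thesis
    unfolding op_ker_def by (metis norm_eq_zero)
qed


section \<open>Partial isometries and polar decompositions\<close>

lemma cadjoint_in_orth_compl_op_ker:
  "bounded_clinear A \<Longrightarrow> cadjoint A y \<in> orth_compl (op_ker A)"
  by (simp add: orth_compl_def op_ker_def cinner_cadjoint_left)

lemma orth_compl_diff:
  "x \<in> orth_compl S \<Longrightarrow> y \<in> orth_compl S \<Longrightarrow> x - y \<in> orth_compl S"
  by (simp add: orth_compl_def cinner_diff_left)

lemma op_ker_orth_compl: "x \<in> op_ker A \<Longrightarrow> x \<in> orth_compl (op_ker A) \<Longrightarrow> x = 0"
  by (auto simp: orth_compl_def cinner_self_eq_zero_iff)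

lemma cadjoint_eq_0I:
  "bounded_clinear A \<Longrightarrow> A (cadjoint A y) = 0 \<Longrightarrow> cadjoint A y = 0"
  by (rule op_ker_orth_compl[where A = A], simp add: op_ker_def,
      erule cadjoint_in_orth_compl_op_ker)

text \<open>By polarization \<open>W\<close> preserves the real parts of inner products of vectors in the orthogonal
  complement of its kernel. For \<open>n\<close> in this complement \<open>W\<^sup>* W n - n\<close> belongs to it and is orthogonal to it.\<close>

lemma partial_isometry_initial:
  assumes "partial_isometry W" and n: "n \<in> orth_compl (op_ker W)"
  shows "cadjoint W (W n) = n"
proof -
  let ?N = "orth_compl (op_ker W)"
  have W: "bounded_clinear W" and iso: "\<And>x. x \<in> ?N \<Longrightarrow> norm (W x) = norm x"
    using assms(1) by (auto simp: partial_isometry_def)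
  define w where "w = cadjoint W (W n) - n"
  have w: "w \<in> ?N"
    unfolding w_def by (intro orth_compl_diff cadjoint_in_orth_compl_op_ker W n)
  have "(norm (W n - W w))\<^sup>2 = (norm (n - w))\<^sup>2"
    using iso[OF orth_compl_diff[OF n w]] by (simp add: bounded_clinear_diff[OF W])
  then have "Re (cinner (W n) (W w)) = Re (cinner n w)"
    by (simp add: norm_diff_squared iso n w)
  then have "Re (cinner w w) = 0"
    by (subst w_def) (simp add: cinner_diff_left cinner_cadjoint_left[OF W])
  then show ?thesis
    by (simp add: w_def flip: norm_squared_cinner)
qed

lemma partial_isometry_cadjoint_triple:
  assumes "partial_isometry W"
  shows "cadjoint W (W (cadjoint W x)) = cadjoint W x"
  using assms
  by (intro partial_isometry_initial cadjoint_in_orth_compl_op_ker)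
    (auto simp: partial_isometry_def)

text \<open>For \<open>x\<close> orthogonal to \<open>ker W\<close>, the vector \<open>W\<^sup>* W x - x\<close> is orthogonal to \<open>ker W\<close> and, by
  the hypothesis, also lies in it.\<close>

lemma partial_isometryI:
  assumes W: "bounded_clinear W" and triple: "\<And>x. W (cadjoint W (W x)) = W x"
  shows "partial_isometry W"
  unfolding partial_isometry_def
proof (intro conjI ballI)
  fix x
  assume x: "x \<in> orth_compl (op_ker W)"
  have "cadjoint W (W x) - x = 0"
  proof (rule op_ker_orth_compl)
    show "cadjoint W (W x) - x \<in> op_ker W"
      by (simp add: op_ker_def bounded_clinear_diff[OF W] triple)
    show "cadjoint W (W x) - x \<in> orth_compl (op_ker W)"
      by (intro orth_compl_diff cadjoint_in_orth_compl_op_ker W x)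
  qed
  then have "(norm (W x))\<^sup>2 = (norm x)\<^sup>2"
    by (simp add: norm_squared_cinner cinner_cadjoint_right[OF W])
  then show "norm (W x) = norm x"
    by (simp add: power2_eq_iff_nonneg)
qed (rule W)

lemma partial_isometry_cadjoint:
  assumes "partial_isometry W"
  shows "partial_isometry (cadjoint W)"
proof (rule partial_isometryI)
  have W: "bounded_clinear W"
    using assms by (simp add: partial_isometry_def)
  then show "bounded_clinear (cadjoint W)" by (rule bounded_clinear_cadjoint)
  show "cadjoint W (cadjoint (cadjoint W) (cadjoint W x)) = cadjoint W x" for x
    by (simp add: cadjoint_cadjoint[OF W] partial_isometry_cadjoint_triple[OF assms])
qed

text \<open>The adjoint of \<open>W\<^sup>* W P = P\<close>, both \<open>P\<close> and \<open>W\<^sup>* W\<close> being self-adjoint.\<close>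

lemma positive_op_absorb_right:
  assumes P: "positive_op P" and W: "bounded_clinear W"
    and "\<And>x. cadjoint W (W (P x)) = P x"
  shows "P (cadjoint W (W x)) = P x"
proof (rule Re_cinner_ext)
  fix z
  have "cinner z (P (cadjoint W (W x))) = cinner (cadjoint W (W (P z))) x"
    by (simp add: W cinner_cadjoint_left cinner_cadjoint_right flip: positive_op_symmetric[OF P])
  then show "Re (cinner z (P (cadjoint W (W x)))) = Re (cinner z (P x))"
    by (simp add: assms(3) positive_op_symmetric[OF P])
qed

lemma positive_op_range_orth_compl:
  "positive_op P \<Longrightarrow> P x \<in> orth_compl (op_ker P)"
  using cadjoint_in_orth_compl_op_ker[of P x]
  by (simp add: positive_op_bounded_clinear cadjoint_positive_op)

lemma polar_decomposition_facts:
  assumes T: "bounded_clinear T" and "polar_decomposition T V P"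
  shows "partial_isometry V" "bounded_clinear V" "positive_op P" "P = abs_op T"
    "T = (\<lambda>x. V (P x))" "op_ker V = op_ker P" "cadjoint V (V (P x)) = P x"
proof -
  have V: "partial_isometry V" and P_eq: "P = abs_op T" and T_eq: "T = V \<circ> P"
    and ker_T: "op_ker V = op_ker T"
    using assms(2) unfolding polar_decomposition_def by blast+
  show "partial_isometry V" and "P = abs_op T" by (rule V, rule P_eq)
  show "bounded_clinear V" using V unfolding partial_isometry_def by blast
  show P: "positive_op P" unfolding P_eq by (rule positive_op_abs_op[OF T])
  show "T = (\<lambda>x. V (P x))" using T_eq unfolding comp_def .
  show ker: "op_ker V = op_ker P"
    unfolding P_eq op_ker_abs_op[OF T] by (rule ker_T)
  show "cadjoint V (V (P x)) = P x"
    by (rule partial_isometry_initial[OF V])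
      (simp add: ker positive_op_range_orth_compl[OF P])
qed

text \<open>Two polar isometries agree on the range of \<open>|T|\<close>, so the adjoint of their difference
  maps into \<open>ker |T|\<close>. The range of either adjoint is orthogonal to this kernel.\<close>

lemma polar_isometry_eq:
  assumes T: "bounded_clinear T" and pd: "polar_decomposition T V P"
  shows "polar_isometry T = V"
proof -
  note V = polar_decomposition_facts[OF T pd]
  have unique: "W = V" if pdW: "polar_decomposition T W (abs_op T)" for W
  proof -
    note W = polar_decomposition_facts[OF T pdW]
    have WV: "W (P x) = V (P x)" for x
      using W(5) V(5) V(4) by (metis)
    have "cadjoint W y = cadjoint V y" for y
    proof -
      have "P (cadjoint W y) = P (cadjoint V y)"
      proof (rule Re_cinner_ext)
        fix x
        have "cinner x (P (cadjoint W y)) = cinner (W (P x)) y"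
          by (simp add: W(2) cinner_cadjoint_right flip: positive_op_symmetric[OF V(3)])
        also have "\<dots> = cinner x (P (cadjoint V y))"
          by (simp add: WV V(2) cinner_cadjoint_right flip: positive_op_symmetric[OF V(3)])
        finally show "Re (cinner x (P (cadjoint W y))) = Re (cinner x (P (cadjoint V y)))"
          by simp
      qed
      then have "cadjoint W y - cadjoint V y \<in> op_ker P"
        by (simp add: op_ker_def bounded_clinear_diff[OF positive_op_bounded_clinear[OF V(3)]])
      moreover have "cadjoint W y - cadjoint V y \<in> orth_compl (op_ker P)"
        using cadjoint_in_orth_compl_op_ker[OF W(2)] cadjoint_in_orth_compl_op_ker[OF V(2)]
          W(6) V(6) V(4) by (intro orth_compl_diff) simp_all
      ultimately have "cadjoint W y - cadjoint V y = 0"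
        by (rule op_ker_orth_compl)
      then show ?thesis by simp
    qed
    then have "cadjoint W = cadjoint V" by blast
    then show ?thesis
      by (metis W(2) V(2) cadjoint_cadjoint)
  qed
  show ?thesis
    unfolding polar_isometry_def
    by (rule the_equality) (use pd V(4) in simp, rule unique)
qed

text \<open>The positive factor is recognized as the absolute value by
  \<open>A\<^sup>* A = Q W\<^sup>* W Q = Q\<^sup>2\<close>.\<close>

lemma polar_decompositionI:
  assumes W: "partial_isometry W" and Q: "positive_op Q"
    and WWQ: "\<And>x. cadjoint W (W (Q x)) = Q x"
    and A: "A = (\<lambda>x. W (Q x))" and ker: "op_ker W = op_ker A"
  shows "polar_decomposition A W Q"
proof -
  have linW: "bounded_clinear W"
    using W by (simp add: partial_isometry_def)
  have "cadjoint A = (\<lambda>x. Q (cadjoint W x))"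
    unfolding A
    by (simp add: cadjoint_mult linW positive_op_bounded_clinear Q cadjoint_positive_op)
  then have "abs_op A = Q"
    by (intro abs_op_eqI Q) (simp add: A WWQ)
  with W ker show ?thesis
    by (simp add: polar_decomposition_def A o_def)
qed


section \<open>The mean transform\<close>

text \<open>Because \<open>W W\<^sup>*\<close> fixes the range of \<open>P\<close>, the factor \<open>W\<close> can be pulled out of
  \<open>P W = W W\<^sup>* P W\<close>, and because \<open>W\<^sup>* W\<close> fixes it, \<open>W\<^sup>* W\<close> fixes the range of the positive factor.
  A vector in the kernel of the positive factor is killed by both positive summands, hence lies
  in the kernels of \<open>P\<close> and \<open>P W\<close>.

  The hypothesis on null vectors is the form of \<open>ker P \<subseteq> ker W\<close> that holds both for \<open>W = V\<close> and for
  \<open>W = V\<^sup>*\<close>: the kernel of \<open>V\<^sup>*\<close> may be properly contained in \<open>ker P\<close>, for instance if \<open>T\<close> is the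
  backward shift.\<close>

lemma polar_decomposition_mean:
  fixes P W :: "'a::chilbert_space \<Rightarrow> 'a"
  assumes W: "partial_isometry W" and P: "positive_op P"
    and init: "\<And>x. cadjoint W (W (P x)) = P x"
    and final: "\<And>x. W (cadjoint W (P x)) = P x"
    and null: "\<And>x. P x = 0 \<Longrightarrow> P (W x) = 0 \<Longrightarrow> W x = 0"
  shows "polar_decomposition (\<lambda>x. (1/2) *\<^sub>R (W (P x) + P (W x))) W
    (\<lambda>x. (1/2) *\<^sub>R (P x + cadjoint W (P (W x))))" (is "polar_decomposition ?M W ?Q")
proof (rule polar_decompositionI[OF W])
  have linW: "bounded_clinear W"
    using W by (simp add: partial_isometry_def)
  note linP = positive_op_bounded_clinear[OF P]
  note linW' = bounded_clinear_cadjoint[OF linW]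
  have form: "cinner (?Q x) y = (1/2) * (cinner (P x) y + cinner (P (W x)) (W y))" for x y
    by (simp add: cinner_simps cinner_cadjoint_left[OF linW])
  show Q: "positive_op ?Q"
  proof (rule symmetric_positive_opI)
    show "bounded_clinear ?Q"
      by (intro bounded_clinear_intros linP bounded_clinear_compose[OF linW']
          bounded_clinear_compose[OF linP linW])
    show "cinner (?Q x) y = cinner x (?Q y)" for x y
      by (simp only: form)
        (simp add: cinner_simps positive_op_symmetric[OF P] flip: cinner_cadjoint_right[OF linW])
    show "0 \<le> Re (cinner (?Q x) x)" for x
      by (simp only: form) (simp add: positive_op_Re_nonneg[OF P])
  qed
  show init_Q: "cadjoint W (W (?Q x)) = ?Q x" for x
    by (simp add: bounded_clinear_simps[OF linW] bounded_clinear_simps[OF linW'] init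
        partial_isometry_cadjoint_triple[OF W])
  show M: "?M = (\<lambda>x. W (?Q x))"
    by (simp add: bounded_clinear_simps[OF linW] final)
  show "op_ker W = op_ker ?M"
  proof (intro set_eqI iffI)
    fix x
    assume "x \<in> op_ker W"
    then have "W x = 0" by (simp add: op_ker_def)
    moreover from this have "P x = 0"
      using positive_op_absorb_right[OF P linW init, of x]
      by (simp add: bounded_clinear_zero[OF linP] bounded_clinear_zero[OF linW'])
    ultimately show "x \<in> op_ker ?M"
      by (simp add: op_ker_def bounded_clinear_zero[OF linP] bounded_clinear_zero[OF linW])
  next
    fix x
    assume "x \<in> op_ker ?M"
    then have "W (?Q x) = 0"
      unfolding M op_ker_def by simp
    then have "?Q x = 0"
      using init_Q[of x] by (metis bounded_clinear_zero[OF linW'])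
    then have "Re (cinner (P x) x + cinner (P (W x)) (W x)) = 0"
      using form[of x x] by (simp only: cinner_zero_left) simp
    then have "Re (cinner (P x) x) = 0" "Re (cinner (P (W x)) (W x)) = 0"
      using positive_op_Re_nonneg[OF P, of x] positive_op_Re_nonneg[OF P, of "W x"] by simp_all
    then have "W x = 0"
      using positive_op_null_vector[OF P] null by blast
    then show "x \<in> op_ker W" by (simp add: op_ker_def)
  qed
qed

text \<open>The kernels of \<open>T\<^sup>*\<close> and \<open>V\<^sup>*\<close> coincide. As \<open>V V\<^sup>* x - x\<close> lies in the latter, the
  hypothesis gives \<open>P V V\<^sup>* = P\<close>, whose adjoint is the claim.\<close>

lemma polar_final_projection:
  assumes T: "bounded_clinear T" and pd: "polar_decomposition T V P"
    and ker: "op_ker (cadjoint T) \<subseteq> op_ker T"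
  shows "V (cadjoint V (P x)) = P x"
proof -
  note V = polar_decomposition_facts[OF T pd]
  note linP = positive_op_bounded_clinear[OF V(3)]
  have adj_T: "cadjoint T = (\<lambda>x. P (cadjoint V x))"
    by (subst V(5)) (simp add: cadjoint_mult V(2) linP cadjoint_positive_op[OF V(3)])
  have "P (V (cadjoint V y)) = P y" for y
  proof -
    have "cadjoint V (V (cadjoint V y) - y) = 0"
      by (simp add: bounded_clinear_diff[OF bounded_clinear_cadjoint[OF V(2)]]
          partial_isometry_cadjoint_triple[OF V(1)])
    then have "V (cadjoint V y) - y \<in> op_ker (cadjoint T)"
      by (simp add: adj_T op_ker_def bounded_clinear_zero[OF linP])
    then have "V (cadjoint V y) - y \<in> op_ker P"
      using ker op_ker_abs_op[OF T] V(4) by auto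
    then show ?thesis
      by (simp add: op_ker_def bounded_clinear_diff[OF linP])
  qed
  note PVV = this
  show ?thesis
  proof (rule Re_cinner_ext)
    fix z
    have "cinner z (V (cadjoint V (P x))) = cinner (P (V (cadjoint V z))) x"
      by (simp only: flip: cinner_cadjoint_left[OF V(2)] cinner_cadjoint_right[OF V(2)]
          positive_op_symmetric[OF V(3)])
    then show "Re (cinner z (V (cadjoint V (P x)))) = Re (cinner z (P x))"
      by (simp add: PVV positive_op_symmetric[OF V(3)])
  qed
qed

theorem proposition2p2:
  fixes T V :: "'a::chilbert_space \<Rightarrow> 'a"
  assumes "bounded_clinear T"
    and "polar_decomposition T V (abs_op T)"
    and "op_ker (cadjoint T) \<subseteq> op_ker T"
  shows "polar_decomposition (mean_transform T) V
           (\<lambda>x. (1/2) *\<^sub>R (abs_op T x + cadjoint V (abs_op T (V x))))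
       \<and> polar_decomposition (cadjoint (mean_transform T)) (cadjoint V)
           (\<lambda>x. (1/2) *\<^sub>R (abs_op T x + V (abs_op T (cadjoint V x))))"
proof -
  define P where "P = abs_op T"
  have pd: "polar_decomposition T V P"
    using assms(2) by (simp add: P_def)
  note V = polar_decomposition_facts[OF assms(1) pd]
  note final = polar_final_projection[OF assms(1) pd assms(3)]
  note linV = V(2) and linV' = bounded_clinear_cadjoint[OF V(2)]
    and linP = positive_op_bounded_clinear[OF V(3)]
  have mean: "mean_transform T = (\<lambda>x. (1/2) *\<^sub>R (V (P x) + P (V x)))"
    by (rule ext) (simp add: mean_transform_def polar_isometry_eq[OF assms(1) pd] P_def[symmetric]
        fun_cong[OF V(5)])
  have mean_adj: "cadjoint (mean_transform T)
      = (\<lambda>x. (1/2) *\<^sub>R (cadjoint V (P x) + P (cadjoint V x)))"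
    unfolding mean
    by (simp add: cadjoint_scaled cadjoint_sum cadjoint_mult bounded_clinear_sum
        bounded_clinear_compose linV linP
        cadjoint_positive_op[OF V(3)] add.commute)
  have ker: "V x = 0" if "P x = 0" for x
    using V(6) that by (auto simp: op_ker_def)
  have "polar_decomposition (mean_transform T) V
      (\<lambda>x. (1/2) *\<^sub>R (P x + cadjoint V (P (V x))))"
    unfolding mean by (rule polar_decomposition_mean[OF V(1,3) V(7) final ker])
  moreover have "polar_decomposition (cadjoint (mean_transform T)) (cadjoint V)
      (\<lambda>x. (1/2) *\<^sub>R (P x + V (P (cadjoint V x))))"
    using polar_decomposition_mean[OF partial_isometry_cadjoint[OF V(1)] V(3)]
      cadjoint_eq_0I[OF linV ker]
    unfolding mean_adj cadjoint_cadjoint[OF linV]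
    by (simp add: V(7) final)
  ultimately show ?thesis by (simp add: P_def)
qed

end
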